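(* For any integers $0\le k\le d-1$, $r_\ell\ge 2$ $(0\le\ell\le k)$ and $0\le\ell^*\le k$, one can choose point sets $C^\ell\subset\mathbb{R}^d$, $0\le\ell\le k$, of size $|C^\ell|=(r_\ell-1)(d-k+1)+1$ and color them with one color class $C^{\ell^*}_j$ (of $C^{\ell^*}$) of size $r_{\ell^*}$ and all other color classes (of all the $C^\ell$) being singletons, such that there are no colorful partitions of the $C^\ell$ into $r_\ell$ pieces each that admit a common $k$-dimensional transversal.
   Context: A coloring of $C^\ell$ is a partition $C^\ell=\biguplus_i C^\ell_i$ into color classes. A colorful partition of $C^\ell$ into $r_\ell$ pieces is a partition of $C^\ell$ into sets $F^\ell_1,\dots,F^\ell_{r_\ell}$ with $|C^\ell_i\cap F^\ell_j|\le1$ for all $i,j$. A common $k$-dimensional transversal is a $k$-dimensional affine subspace $P$ of $\mathbb{R}^d$ that intersects all the convex hulls $\mathrm{conv}(F^\ell_j)$, $0\le\ell\le k$, $1\le j\le r_\ell$. *)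

theory Defs
  imports "HOL-Analysis.Analysis" "HOL-Library.Disjoint_Sets"
begin

text \<open>A coloring is represented by its set of (nonempty) color classes.\<close>

definition coloring :: "'a set \<Rightarrow> 'a set set \<Rightarrow> bool" where
  "coloring C cols \<longleftrightarrow> partition_on C cols"

text \<open>
  The pieces are indexed, and empty pieces are allowed.  A partition with an empty piece has no
  common transversal, because the convex hull of the empty set is empty.
  The cardinality bound is meaningful for finite \<open>C\<close> only.
\<close>

definition colorful_partition ::
  "'a set \<Rightarrow> 'a set set \<Rightarrow> nat \<Rightarrow> (nat \<Rightarrow> 'a set) \<Rightarrow> bool" where
  "colorful_partition C cols r F \<longleftrightarrow>
     disjoint_family_on F {1..r} \<and> (\<Union>j\<in>{1..r}. F j) = C \<and>
     (\<forall>K\<in>cols. \<forall>j\<in>{1..r}. card (K \<inter> F j) \<le> 1)"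

definition common_transversal ::
  "nat \<Rightarrow> (nat \<Rightarrow> nat) \<Rightarrow> (nat \<Rightarrow> nat \<Rightarrow> 'a::euclidean_space set) \<Rightarrow> 'a set \<Rightarrow> bool" where
  "common_transversal k r F P \<longleftrightarrow>
     affine P \<and> aff_dim P = int k \<and>
     (\<forall>l\<in>{0..k}. \<forall>j\<in>{1..r l}. P \<inter> convex hull (F l j) \<noteq> {})"

end

theory Submission
  imports Defs
begin

text \<open>
  The case \<open>k = 0\<close> is the heart of the matter. Take \<open>m + 1\<close> directions in an \<open>m\<close>-dimensional
  space that positively span it and add up to zero, put \<open>r - 1\<close> points on the ray of each
  direction, and add the origin. Each ray has fewer points than there are pieces, so each ray is
  missed by some piece; the cones spanned by all but one direction meet only in the origin, so the
  origin is the only possible common point of the convex hulls. A piece that does not contain the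
  origin as an element, but has it in its hull, must meet every ray. By counting, each of the
  other \<open>r - 1\<close> pieces then has exactly one point of each ray. This is forbidden by the
  color class made of all points of one ray and a single point of another ray: that single point
  would share its piece with a point of the first ray (\<open>no_colorful_Tverberg_point\<close>).

  For general \<open>k\<close>, split the coordinates into \<open>k\<close> and \<open>d - k\<close> of them, and place \<open>C\<^sup>l\<close> in the
  fibre over the \<open>l\<close>-th vertex of a \<open>k\<close>-simplex. A \<open>k\<close>-flat that meets all \<open>k + 1\<close> fibres projects
  bijectively, so it meets each fibre in a single point (\<open>transversal_meets_fibre_once\<close>). This
  point would be a common point of the hulls inside the fibre over the distinguished vertex, where
  the configuration above has been placed.
\<close>

section \<open>Fans of directions and points on their rays\<close>

text \<open>
  A finite set \<open>D\<close> of at least two directions in \<open>V\<close> forms a fan if there are functionals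
  \<open>g w\<close>, given by inner products, that are positive on every direction but \<open>w\<close>, add up to zero, and together separate
  the points of \<open>V\<close> from the origin. The vertices of a simplex with barycentre \<open>0\<close> are the example:
  \<open>g w\<close> is then the outer normal of the facet opposite to \<open>w\<close>, scaled to be \<open>1\<close> on that facet.
\<close>

definition fan :: "'a::euclidean_space set \<Rightarrow> 'a set \<Rightarrow> ('a \<Rightarrow> 'a) \<Rightarrow> bool" where
  "fan V D g \<longleftrightarrow> subspace V \<and> finite D \<and> card D \<ge> 2 \<and> D \<subseteq> V \<and>
     (\<forall>v\<in>D. \<forall>w\<in>D. v \<noteq> w \<longrightarrow> v \<bullet> g w > 0) \<and> (\<Sum>w\<in>D. g w) = 0 \<and>
     (\<forall>x\<in>V. (\<forall>w\<in>D. x \<bullet> g w = 0) \<longrightarrow> x = 0)"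

text \<open>Distinct points that stand in for \<open>n\<close> copies of a vector \<open>v \<noteq> 0\<close>: \<open>v, 2v, \<dots>, nv\<close>.\<close>

definition ray_points :: "nat \<Rightarrow> 'a::real_vector \<Rightarrow> 'a set" where
  "ray_points n v = (\<lambda>t. real t *\<^sub>R v) ` {1..n}"

text \<open>The points on all rays, together with their common apex.\<close>

definition fan_points :: "nat \<Rightarrow> 'a::real_vector set \<Rightarrow> 'a set" where
  "fan_points n D = insert 0 (\<Union>v\<in>D. ray_points n v)"

lemma fan_inner_self_neg:
  assumes "fan V D g" "w \<in> D"
  shows "w \<bullet> g w < 0"
proof -
  have fin: "finite D" and c2: "card D \<ge> 2"
    and pos: "\<And>v. v \<in> D \<Longrightarrow> w \<noteq> v \<Longrightarrow> w \<bullet> g v > 0" and s0: "(\<Sum>v\<in>D. g v) = 0"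
    using assms by (auto simp: fan_def)
  have "card (D - {w}) \<ge> 1" using fin c2 assms(2) by simp
  then have "D - {w} \<noteq> {}" by (metis card.empty not_one_le_zero)
  then have "(\<Sum>v\<in>D - {w}. w \<bullet> g v) > 0"
    using fin pos by (intro sum_pos) auto
  moreover have "0 = w \<bullet> g w + (\<Sum>v\<in>D - {w}. w \<bullet> g v)"
    using sum.remove[OF fin assms(2), of "\<lambda>v. w \<bullet> g v"] s0 by (metis inner_sum_right inner_zero_right)
  ultimately show ?thesis by linarith
qed

lemma finite_ray_points: "finite (ray_points n v)"
  by (simp add: ray_points_def)

lemma card_ray_points:
  assumes "v \<noteq> 0"
  shows "card (ray_points n v) = n"
  unfolding ray_points_def using assms by (subst card_image) (auto simp: inj_on_def)

lemma zero_notin_ray_points: "v \<noteq> 0 \<Longrightarrow> 0 \<notin> ray_points n v"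
  by (auto simp: ray_points_def)

lemma fan_direction_nonzero: "fan V D g \<Longrightarrow> v \<in> D \<Longrightarrow> v \<noteq> 0"
  using fan_inner_self_neg by fastforce

lemma ray_points_disjoint:
  assumes "fan V D g" "v \<in> D" "w \<in> D" "v \<noteq> w"
  shows "ray_points n v \<inter> ray_points n' w = {}"
proof -
  have "False" if "t \<ge> 1" "s \<ge> 1" "real t *\<^sub>R v = real s *\<^sub>R w" for t s :: nat
  proof -
    have "v \<bullet> g w > 0" using assms by (auto simp: fan_def)
    then have "real t * (v \<bullet> g w) > 0" using that by simp
    moreover have "real s * (w \<bullet> g w) < 0"
      using fan_inner_self_neg[OF assms(1,3)] that by (simp add: mult_pos_neg)
    ultimately show False using that(3) by (metis inner_scaleR_left not_less_iff_gr_or_eq)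
  qed
  then show ?thesis by (auto simp: ray_points_def)
qed

lemma card_fan_points:
  assumes "fan V D g"
  shows "card (fan_points n D) = n * card D + 1"
proof -
  have fin: "finite D" using assms by (simp add: fan_def)
  have "card (\<Union>v\<in>D. ray_points n v) = (\<Sum>v\<in>D. card (ray_points n v))"
    using fin ray_points_disjoint[OF assms]
    by (intro card_UN_disjoint) (auto simp: finite_ray_points)
  also have "\<dots> = n * card D"
    by (simp add: card_ray_points fan_direction_nonzero[OF assms])
  finally have c: "card (\<Union>v\<in>D. ray_points n v) = n * card D" .
  have "0 \<notin> (\<Union>v\<in>D. ray_points n v)"
    using zero_notin_ray_points fan_direction_nonzero[OF assms] by blast
  then show ?thesis
    unfolding fan_points_def using c fin by (simp add: finite_ray_points)
qed

lemma fan_points_subset: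
  assumes "fan V D g"
  shows "fan_points n D \<subseteq> V"
  using assms
  by (auto simp: fan_def fan_points_def ray_points_def intro: subspace_scale subspace_0)

section \<open>The color class that prevents a Tverberg point\<close>

lemma missed_ray_inner_pos:
  assumes "fan V D g" "w \<in> D" "y \<in> fan_points n D" "y \<notin> ray_points n w" "y \<noteq> 0"
  shows "y \<bullet> g w > 0"
proof -
  obtain v where "v \<in> D" "y \<in> ray_points n v"
    using assms(3,5) by (auto simp: fan_points_def)
  moreover from this obtain t :: nat where "t \<ge> 1" "y = real t *\<^sub>R v"
    by (auto simp: ray_points_def)
  ultimately have v: "v \<in> D" "t \<ge> 1" "y = real t *\<^sub>R v" "y \<in> ray_points n v"
    by auto
  then have "v \<noteq> w" using assms(4) by auto
  then have "v \<bullet> g w > 0" using assms(1,2) v(1) by (auto simp: fan_def)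
  then show ?thesis using v by simp
qed

lemma missed_ray_hull_nonneg:
  assumes "fan V D g" "w \<in> D" "F \<subseteq> fan_points n D" "F \<inter> ray_points n w = {}" "x \<in> convex hull F"
  shows "x \<bullet> g w \<ge> 0"
proof -
  have "F \<subseteq> {y. g w \<bullet> y \<ge> 0}"
    using missed_ray_inner_pos[OF assms(1,2)] assms(3,4)
    by (smt (verit) disjoint_iff inner_commute inner_zero_left mem_Collect_eq subset_iff)
  then have "convex hull F \<subseteq> {y. g w \<bullet> y \<ge> 0}"
    by (rule hull_minimal) (rule convex_halfspace_ge)
  then show ?thesis using assms(5) by (auto simp: inner_commute)
qed

lemma zero_in_hull_meets_ray:
  assumes "fan V D g" "w \<in> D" "F \<subseteq> fan_points n D" "0 \<notin> F" "0 \<in> convex hull F"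
  shows "F \<inter> ray_points n w \<noteq> {}"
proof
  assume e: "F \<inter> ray_points n w = {}"
  have "F \<subseteq> {y. g w \<bullet> y > 0}"
    using missed_ray_inner_pos[OF assms(1,2)] assms(3,4) e
    by (auto simp: inner_commute)
  then have "convex hull F \<subseteq> {y. g w \<bullet> y > 0}"
    by (rule hull_minimal) (rule convex_halfspace_gt)
  then show False using assms(5) by auto
qed

text \<open>
  The pigeonhole principle for a disjoint family all of whose members meet \<open>A\<close>; in the case of
  equality the members pick out all elements of \<open>A\<close>.
\<close>

lemma disjoint_family_meets_card:
  assumes "finite A" "disjoint_family_on F J" "\<forall>j\<in>J. F j \<inter> A \<noteq> {}"
  shows "card J \<le> card A"
    and "card J = card A \<Longrightarrow> a \<in> A \<Longrightarrow> \<exists>j\<in>J. a \<in> F j"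
proof -
  have "\<forall>j\<in>J. \<exists>a. a \<in> F j \<inter> A" using assms(3) by blast
  from bchoice[OF this] obtain h where h: "\<And>j. j \<in> J \<Longrightarrow> h j \<in> F j \<inter> A"
    by blast
  have inj: "inj_on h J"
    using h assms(2) by (fastforce simp: inj_on_def disjoint_family_on_def)
  have sub: "h ` J \<subseteq> A" using h by auto
  show "card J \<le> card A" using inj sub assms(1) by (rule card_inj_on_le)
  show "\<exists>j\<in>J. a \<in> F j" if "card J = card A" "a \<in> A"
  proof -
    have "h ` J = A"
      using card_subset_eq[OF assms(1) sub] card_image[OF inj] that by simp
    then show ?thesis using h that by blast
  qed
qed

lemma no_colorful_Tverberg_point:
  assumes fan: "fan V D g" and r: "r \<ge> 2"
    and v: "v0 \<in> D" "v1 \<in> D" "v0 \<noteq> v1"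
    and disj: "disjoint_family_on F {1..r}"
    and Un: "(\<Union>j\<in>{1..r}. F j) = fan_points (r - 1) D"
    and col: "\<forall>j\<in>{1..r}. card (insert v1 (ray_points (r - 1) v0) \<inter> F j) \<le> 1"
    and x: "\<forall>j\<in>{1..r}. x \<in> convex hull (F j)"
  shows False
proof -
  have sub: "F j \<subseteq> fan_points (r - 1) D" if "j \<in> {1..r}" for j
    using Un that by blast
  \<comment> \<open>Every ray has only \<open>r - 1\<close> points, so it is missed by one of the \<open>r\<close> pieces.\<close>
  have nonneg: "x \<bullet> g w \<ge> 0" if w: "w \<in> D" for w
  proof -
    have "card (ray_points (r - 1) w) < card {1..r}"
      using card_ray_points[OF fan_direction_nonzero[OF fan w], of "r - 1"] r by simp
    then have "\<exists>j\<in>{1..r}. F j \<inter> ray_points (r - 1) w = {}"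
      using disjoint_family_meets_card(1)[OF finite_ray_points disj] by (meson not_less)
    then show ?thesis
      using missed_ray_hull_nonneg[OF fan w] sub x by blast
  qed
  have "x = 0"
  proof -
    have "fan_points (r - 1) D \<subseteq> V" and V: "convex V"
      using fan_points_subset[OF fan] fan by (auto simp: fan_def subspace_imp_convex)
    then have "convex hull (F 1) \<subseteq> V"
      using sub[of 1] r by (intro hull_minimal) auto
    then have "x \<in> V" using x r by auto
    moreover have "(\<Sum>w\<in>D. x \<bullet> g w) = 0" and "finite D"
      using fan by (auto simp: fan_def simp flip: inner_sum_right)
    then have "\<forall>w\<in>D. x \<bullet> g w = 0"
      using nonneg by (simp add: sum_nonneg_eq_0_iff)
    ultimately show ?thesis using fan by (auto simp: fan_def)
  qed
  have "0 \<in> (\<Union>j\<in>{1..r}. F j)" using Un by (simp add: fan_points_def)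
  then obtain j0 where j0: "j0 \<in> {1..r}" "0 \<in> F j0" by blast
  define J where "J = {1..r} - {j0}"
  have meets: "F j \<inter> ray_points (r - 1) w \<noteq> {}" if "j \<in> J" "w \<in> D" for j w
  proof (rule zero_in_hull_meets_ray[OF fan that(2)])
    show "0 \<notin> F j"
      using disjoint_family_onD[OF disj j0(1), of j] j0(2) that(1) by (auto simp: J_def)
  qed (use sub x \<open>x = 0\<close> that(1) in \<open>auto simp: J_def\<close>)
  have "card J = card (ray_points (r - 1) v1)"
    using card_ray_points[OF fan_direction_nonzero[OF fan v(2)]] j0(1) by (simp add: J_def)
  moreover have v1: "v1 \<in> ray_points (r - 1) v1"
    using r by (auto simp: ray_points_def intro!: image_eqI[of _ _ 1])
  moreover have "disjoint_family_on F J"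
    using disj by (auto simp: J_def disjoint_family_on_def)
  ultimately obtain j1 where j1: "j1 \<in> J" "v1 \<in> F j1"
    using disjoint_family_meets_card(2)[OF finite_ray_points, of F J "r - 1" v1 v1] meets v(2) by blast
  obtain y where y: "y \<in> F j1" "y \<in> ray_points (r - 1) v0"
    using meets[OF j1(1) v(1)] by blast
  have "y \<noteq> v1" using ray_points_disjoint[OF fan v] y v1 by blast
  then have "card {y, v1} = 2" by simp
  moreover have "card {y, v1} \<le> card (insert v1 (ray_points (r - 1) v0) \<inter> F j1)"
    using y j1 by (intro card_mono) (auto simp: finite_ray_points)
  moreover have "card (insert v1 (ray_points (r - 1) v0) \<inter> F j1) \<le> 1"
    using col j1(1) unfolding J_def by blast
  ultimately show False by linarith
qed

section \<open>A simplicial fan in a coordinate subspace\<close>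

text \<open>
  The directions are the basis vectors and the negative of their sum \<open>s\<close>. The functional for \<open>-s\<close>
  is \<open>s\<close>, and for a basis vector \<open>b\<close> it is \<open>s - (m + 1) b\<close>, with value \<open>1\<close> on \<open>-s\<close> and on
  the other basis vectors.
\<close>

lemma coordinate_fan_exists:
  fixes M :: "'a::euclidean_space set"
  assumes M: "M \<subseteq> Basis" "M \<noteq> {}"
  shows "\<exists>D g. fan (span M) D g \<and> card D = card M + 1"
proof -
  have fin: "finite M" using M finite_subset finite_Basis by blast
  define s where "s = \<Sum>M"
  define D where "D = insert (- s) M"
  define g where "g w = (if w = - s then s else s - (real (card M) + 1) *\<^sub>R w)" for w
  have bb: "b \<bullet> c = (if b = c then 1 else 0)" if "b \<in> M" "c \<in> M" for b c
    by (rule inner_Basis) (use M(1) that in blast)+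
  have bs: "b \<bullet> s = 1" if "b \<in> M" for b
  proof -
    have "b \<bullet> s = (\<Sum>c\<in>M. if c = b then 1 else 0)"
      unfolding s_def inner_sum_right using M that
      using bb[OF that] by (intro sum.cong) auto
    then show ?thesis using fin that by simp
  qed
  have ss: "s \<bullet> s = real (card M)"
    using bs by (subst (1) s_def) (simp add: inner_sum_left)
  have notin: "- s \<notin> M"
  proof
    assume a: "- s \<in> M"
    have "(- s) \<bullet> s = 1" using bs[OF a] .
    then show False using ss by simp
  qed
  have gM: "g b = s - (real (card M) + 1) *\<^sub>R b" if "b \<in> M" for b
    using that notin by (auto simp: g_def)
  have cardD: "card D = card M + 1" using fin notin by (simp add: D_def)
  have "card M \<ge> 1" using fin M(2) by (simp add: Suc_leI card_gt_0_iff)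
  have "(\<Sum>w\<in>D. g w) = s + (\<Sum>b\<in>M. s - (real (card M) + 1) *\<^sub>R b)"
    using fin notin gM by (simp add: D_def g_def)
  also have "\<dots> = s + (real (card M) *\<^sub>R s - (real (card M) + 1) *\<^sub>R s)"
    unfolding sum_subtractf scaleR_sum_right[symmetric] sum_constant_scaleR s_def[symmetric] ..
  also have "\<dots> = 0" by (simp add: algebra_simps)
  finally have sum0: "(\<Sum>w\<in>D. g w) = 0" .
  have pos: "v \<bullet> g w > 0" if "v \<in> D" "w \<in> D" "v \<noteq> w" for v w
  proof (cases "w = - s")
    case True
    then have "v \<in> M" using that by (simp add: D_def)
    then show ?thesis using True bs by (simp add: g_def)
  next
    case False
    then have w: "w \<in> M" using that by (simp add: D_def)
    show ?thesis
    proof (cases "v = - s")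
      case True
      then show ?thesis using w bs[OF w] ss
        by (simp add: gM inner_diff_right inner_commute)
    next
      case False
      then have "v \<in> M" using that by (simp add: D_def)
      then show ?thesis using w that(3) bs bb by (simp add: gM inner_diff_right)
    qed
  qed
  have sep: "x = 0" if x: "x \<in> span M" "\<forall>w\<in>D. x \<bullet> g w = 0" for x
  proof -
    have "x \<bullet> s = 0" using x(2) by (auto simp: D_def g_def)
    have xb: "x \<bullet> b = 0" if "b \<in> M" for b
    proof -
      have "x \<bullet> g b = 0" using x(2) that by (simp add: D_def)
      then show ?thesis
        unfolding gM[OF that] inner_diff_right \<open>x \<bullet> s = 0\<close> by simp
    qed
    have "orthogonal x y" if "y \<in> span M" for y
      by (rule orthogonal_to_span[OF that]) (simp add: orthogonal_def xb)
    then show ?thesis using x(1) orthogonal_self by blast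
  qed
  have "- s \<in> span M"
    unfolding s_def by (intro span_neg span_sum span_base)
  then have "D \<subseteq> span M"
    unfolding D_def by (simp add: span_superset)
  then have "fan (span M) D g"
    unfolding fan_def using fin cardD \<open>card M \<ge> 1\<close> sum0 pos sep by (auto simp: D_def)
  then show ?thesis using cardD by blast
qed

section \<open>Flats that meet all fibres over a simplex\<close>

text \<open>
  With \<open>W\<close> the fibre direction and \<open>S\<close> the direction space of \<open>P\<close>, the hypothesis gives
  \<open>S + W = \<real>\<^sup>d\<close>; since the dimensions add up to \<open>d\<close>, the intersection \<open>S \<inter> W\<close> is trivial.
\<close>

lemma transversal_meets_fibre_once:
  fixes P B :: "'a::euclidean_space set"
  assumes P: "affine P" "aff_dim P = int (card B)"
    and B: "B \<subseteq> Basis"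
    and meets: "\<forall>b\<in>insert 0 B. \<exists>q\<in>P. q - b \<in> span (Basis - B)"
    and xy: "x \<in> P" "y \<in> P" "x - y \<in> span (Basis - B)"
  shows "x = y"
proof -
  define W where "W = span (Basis - B)"
  obtain q0 where q0: "q0 \<in> P" "q0 \<in> W"
    using meets by (auto simp: W_def)
  define S where "S = (\<lambda>u. u - q0) ` P"
  have S: "subspace S"
    unfolding S_def using affine_diffs_subspace_subtract[OF P(1) q0(1)] .
  have dimS: "dim S = card B"
    using aff_dim_dim_affine_diffs[OF P(1) q0(1)] P(2) S_def by simp
  have W: "subspace W" by (simp add: W_def)
  have dimW: "dim W = DIM('a) - card B"
    using B by (simp add: W_def dim_eq_card_independent independent_mono[OF independent_Basis]
        card_Diff_subset finite_subset[OF _ finite_Basis])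
  define T where "T = {u + w |u w. u \<in> S \<and> w \<in> W}"
  have T: "subspace T" unfolding T_def by (rule subspace_sums[OF S W])
  have "b \<in> T" if "b \<in> Basis" for b
  proof (cases "b \<in> B")
    case True
    then obtain q where q: "q \<in> P" "q - b \<in> W" using meets by (auto simp: W_def)
    have "b = (q - q0) + (q0 - (q - b))" by simp
    moreover have "q - q0 \<in> S" using q by (auto simp: S_def)
    moreover have "q0 - (q - b) \<in> W" using subspace_diff[OF W q0(2) q(2)] .
    ultimately show ?thesis unfolding T_def by blast
  next
    case False
    then have "b \<in> W" using that by (auto simp: W_def intro: span_base)
    moreover have "0 \<in> S" using S subspace_0 by blast
    moreover have "b = 0 + b" by simp
    ultimately show ?thesis unfolding T_def by blast
  qed
  then have "span Basis \<subseteq> T" using T by (intro span_minimal) auto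
  then have "dim T = DIM('a)" by (simp add: top.extremum_unique)
  then have "dim (S \<inter> W) = 0"
    using dim_sums_Int[OF S W] dimS dimW card_mono[OF finite_Basis B]
    unfolding T_def by linarith
  moreover have "x - y \<in> S"
  proof -
    have "x - q0 \<in> S" "y - q0 \<in> S" using xy by (auto simp: S_def)
    then show ?thesis using subspace_diff[OF S] by fastforce
  qed
  ultimately show ?thesis using xy(3) by (auto simp: W_def)
qed

section \<open>Colorings and the counterexample\<close>

lemma partition_on_singletons: "partition_on C ((\<lambda>x. {x}) ` C)"
  by (auto simp: partition_on_def disjoint_def)

lemma partition_on_one_class:
  assumes "K \<subseteq> C" "K \<noteq> {}"
  shows "partition_on C (insert K ((\<lambda>x. {x}) ` (C - K)))"
  using assms by (auto simp: partition_on_def disjoint_def)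

text \<open>The translated form of \<open>no_colorful_Tverberg_point\<close>.\<close>

lemma no_colorful_partition_with_common_point:
  assumes fan: "fan V D g" and r: "r \<ge> 2"
    and v: "v0 \<in> D" "v1 \<in> D" "v0 \<noteq> v1"
    and part: "colorful_partition ((+) p ` fan_points (r - 1) D) cols r F"
    and K: "(+) p ` insert v1 (ray_points (r - 1) v0) \<in> cols"
  shows "\<not> (\<forall>j\<in>{1..r}. x \<in> convex hull (F j))"
proof
  assume x: "\<forall>j\<in>{1..r}. x \<in> convex hull (F j)"
  define G where "G j = (+) (- p) ` F j" for j
  have inj: "inj ((+) (- p))" by simp
  have shift: "(+) (- p) ` (+) p ` A = A" for A :: "'a set"
    by (simp add: image_image)
  show False
  proof (rule no_colorful_Tverberg_point[OF fan r v, of G "- p + x"])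
    have "G i \<inter> G j = (+) (- p) ` (F i \<inter> F j)" for i j
      unfolding G_def image_Int[OF inj] ..
    then show "disjoint_family_on G {1..r}"
      using part by (simp add: colorful_partition_def disjoint_family_on_def)
    have "(\<Union>j\<in>{1..r}. G j) = (+) (- p) ` (\<Union>j\<in>{1..r}. F j)"
      by (auto simp: G_def)
    then show "(\<Union>j\<in>{1..r}. G j) = fan_points (r - 1) D"
      using part shift by (simp add: colorful_partition_def)
    show "\<forall>j\<in>{1..r}. card (insert v1 (ray_points (r - 1) v0) \<inter> G j) \<le> 1"
    proof
      fix j assume j: "j \<in> {1..r}"
      have "insert v1 (ray_points (r - 1) v0) \<inter> G j
          = (+) (- p) ` ((+) p ` insert v1 (ray_points (r - 1) v0) \<inter> F j)"
        unfolding G_def image_Int[OF inj] shift ..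
      then show "card (insert v1 (ray_points (r - 1) v0) \<inter> G j) \<le> 1"
        using part K j by (simp add: card_image colorful_partition_def del: image_insert)
    qed
    show "\<forall>j\<in>{1..r}. - p + x \<in> convex hull (G j)"
      using x unfolding G_def convex_hull_translation by blast
  qed
qed

theorem mainTheorem5:
  fixes k lstar :: nat and r :: "nat \<Rightarrow> nat"
  assumes "k < CARD('n::finite)"
    and "\<forall>l\<in>{0..k}. r l \<ge> 2"
    and "lstar \<in> {0..k}"
  shows "\<exists>(C :: nat \<Rightarrow> (real ^ 'n) set) (cols :: nat \<Rightarrow> (real ^ 'n) set set).
           (\<forall>l\<in>{0..k}. card (C l) = (r l - 1) * (CARD('n) - k + 1) + 1 \<and> coloring (C l) (cols l)) \<and>
           (\<exists>K\<in>cols lstar. card K = r lstar \<and>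
              (\<forall>l\<in>{0..k}. \<forall>K'\<in>cols l. (l, K') \<noteq> (lstar, K) \<longrightarrow> is_singleton K')) \<and>
           \<not> (\<exists>F. (\<forall>l\<in>{0..k}. colorful_partition (C l) (cols l) (r l) (F l)) \<and>
                (\<exists>P. common_transversal k r F P))"
proof -
  have "k \<le> card (Basis :: (real ^ 'n) set)" using assms(1) by simp
  then obtain B :: "(real ^ 'n) set" where B: "B \<subseteq> Basis" "card B = k"
    by (metis obtain_subset_with_card_n)
  have finB: "finite B" using B(1) finite_Basis finite_subset by blast
  define M where "M = Basis - B"
  have cardM: "card M = CARD('n) - k"
    using B finB by (simp add: M_def card_Diff_subset)
  then have "M \<noteq> {}" using assms(1) by auto
  then obtain D g where fan: "fan (span M) D g" and cardD: "card D = card M + 1"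
    using coordinate_fan_exists[of M] by (auto simp: M_def)
  \<comment> \<open>The vertices of the simplex are \<open>0\<close> and the vectors of \<open>B\<close>; \<open>span M\<close> is the fibre direction.\<close>
  have "0 \<notin> B" using B(1) nonzero_Basis by blast
  then have "card (insert 0 B) = card {0..k}" using finB B(2) by simp
  then obtain p where p: "bij_betw p {0..k} (insert 0 B)"
    using finite_same_card_bij[of "{0..k}" "insert 0 B"] finB by auto
  have "card D \<ge> 2" using fan by (simp add: fan_def)
  then obtain v0 v1 where v: "v0 \<in> D" "v1 \<in> D" "v0 \<noteq> v1"
    by (metis card_2_iff' obtain_subset_with_card_n subset_iff)
  define n where "n l = r l - 1" for l
  define C where "C l = (+) (p l) ` fan_points (n l) D" for l
  define K where "K = (+) (p lstar) ` insert v1 (ray_points (n lstar) v0)"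
  define cols where
    "cols l = (if l = lstar then insert K ((\<lambda>x. {x}) ` (C l - K)) else (\<lambda>x. {x}) ` C l)" for l
  have r2: "r lstar \<ge> 2" using assms(2,3) by blast
  have v1: "v1 \<in> ray_points (n lstar) v1"
    using r2 by (auto simp: n_def ray_points_def intro!: image_eqI[of _ _ 1])
  have "K \<subseteq> C lstar"
    unfolding K_def C_def using v v1 by (intro image_mono) (auto simp: fan_points_def)
  moreover have "K \<noteq> {}" by (simp add: K_def)
  ultimately have coloring: "coloring (C l) (cols l)" for l
    by (simp add: coloring_def cols_def partition_on_singletons partition_on_one_class)
  have cardC: "card (C l) = (r l - 1) * (CARD('n) - k + 1) + 1" for l
    using card_fan_points[OF fan] by (simp add: C_def n_def card_image cardD cardM)
  have "v1 \<notin> ray_points (n lstar) v0"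
    using ray_points_disjoint[OF fan v] v1 by blast
  then have cardK: "card K = r lstar"
    unfolding K_def using card_ray_points[OF fan_direction_nonzero[OF fan v(1)]] r2
    by (subst card_image) (auto simp: finite_ray_points n_def)
  have no: False
    if F: "\<forall>l\<in>{0..k}. colorful_partition (C l) (cols l) (r l) (F l)"
      and tr: "common_transversal k r F P" for F P
  proof -
    have P: "affine P" "aff_dim P = int (card B)"
      using tr B by (auto simp: common_transversal_def)
    have hit: "\<exists>x\<in>P. x \<in> convex hull (F l j)" if "l \<in> {0..k}" "j \<in> {1..r l}" for l j
      using tr that unfolding common_transversal_def by (meson disjoint_iff)
    have fibre: "x - p l \<in> span M"
      if "l \<in> {0..k}" "j \<in> {1..r l}" "x \<in> convex hull (F l j)" for l j x
    proof -
      have "(\<Union>i\<in>{1..r l}. F l i) = C l"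
        using F that(1) by (simp add: colorful_partition_def)
      then have "F l j \<subseteq> C l" using that(2) by blast
      also have "\<dots> \<subseteq> (+) (p l) ` span M"
        unfolding C_def using fan_points_subset[OF fan] by (rule image_mono)
      finally have "convex hull (F l j) \<subseteq> (+) (p l) ` span M"
        by (intro hull_minimal) (auto intro!: convex_translation subspace_imp_convex)
      then show ?thesis using that(3) by auto
    qed
    have meets: "\<forall>b\<in>insert 0 B. \<exists>q\<in>P. q - b \<in> span (Basis - B)"
    proof
      fix b assume "b \<in> insert 0 B"
      then obtain l where l: "l \<in> {0..k}" "b = p l"
        using bij_betw_imp_surj_on[OF p] by blast
      then have "1 \<in> {1..r l}" using assms(2) by fastforce
      then show "\<exists>q\<in>P. q - b \<in> span (Basis - B)"
        using hit[OF l(1)] fibre[OF l(1)] l(2) by (metis M_def)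
    qed
    have "1 \<in> {1..r lstar}" using r2 by simp
    then obtain x where x: "x \<in> P" "x \<in> convex hull (F lstar 1)"
      using hit[OF assms(3)] by blast
    have "x \<in> convex hull (F lstar j)" if j: "j \<in> {1..r lstar}" for j
    proof -
      obtain y where y: "y \<in> P" "y \<in> convex hull (F lstar j)"
        using hit[OF assms(3) j] by blast
      have "(x - p lstar) - (y - p lstar) \<in> span M"
        using fibre[OF assms(3) \<open>1 \<in> {1..r lstar}\<close> x(2)] fibre[OF assms(3) j y(2)]
        by (rule span_diff)
      then have "x = y"
        using transversal_meets_fibre_once[OF P B(1) meets x(1) y(1)] by (simp add: M_def)
      then show ?thesis using y by simp
    qed
    moreover have "colorful_partition ((+) (p lstar) ` fan_points (r lstar - 1) D)
        (cols lstar) (r lstar) (F lstar)"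
      using F assms(3) by (simp add: C_def n_def)
    moreover have "(+) (p lstar) ` insert v1 (ray_points (r lstar - 1) v0) \<in> cols lstar"
      by (simp add: cols_def K_def n_def)
    ultimately show False
      using no_colorful_partition_with_common_point[OF fan r2 v] by blast
  qed
  show ?thesis
  proof (intro exI[of _ C] exI[of _ cols] conjI bexI[of _ K])
    show "\<forall>l\<in>{0..k}. \<forall>K'\<in>cols l. (l, K') \<noteq> (lstar, K) \<longrightarrow> is_singleton K'"
      by (auto simp: cols_def split: if_splits)
    show "K \<in> cols lstar" by (simp add: cols_def)
  qed (use coloring cardC cardK no in auto)
qed

end
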